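(* Let $\Bbbk$ be a field of characteristic zero and let $A=\Bbbk[x_1,\ldots,x_n]$ be a weighted graded Poisson algebra with $\deg x_i>0$ for all $i$, with Poisson structure $\pi$ and modular derivation ${\mathbf m}$. Let $\mathfrak{l}=\sum_{i=1}^n\deg(x_i)$ and $\delta=-\frac{1}{\mathfrak{l}}{\mathbf m}$. Then the graded twist $A^{\delta}$ is unimodular. As a consequence, $$\pi=\pi_{unim}+\frac{1}{\sum_{i=1}^n\deg x_i}\,E\wedge{\mathbf m},$$ where $\pi_{unim}$ (the Poisson structure of $A^\delta$) is a unimodular graded Poisson structure on $\Bbbk[x_1,\ldots,x_n]$.
   Context: A graded Poisson algebra here is $\Bbbk[x_1,\ldots,x_n]$, $\mathbb{Z}$-graded with each $x_i$ homogeneous, with a Poisson bracket $\pi=\{-,-\}$ graded of degree $0$: $\deg\{a,b\}=\deg a+\deg b$ for homogeneous $a,b$. For homogeneous $a$, $|a|=\deg a$; the Euler derivation is $E(a)=|a|\,a$ for homogeneous $a$. For derivations $\phi,\psi$, $(\phi\wedge\psi)(a,b)=\phi(a)\psi(b)-\psi(a)\phi(b)$. For a graded Poisson derivation $\delta$ of degree $0$, the graded twist $A^{\delta}$ is the same commutative graded algebra with Poisson bracket $\pi+E\wedge\delta$, i.e. $\{a,b\}_{new}=\{a,b\}+E(a)\delta(b)-\delta(a)E(b)$. The divergence of a derivation is $\operatorname{div}(\delta)=\sum_{i}\frac{\partial\delta(x_i)}{\partial x_i}$. With $H_a=\{a,-\}$, the modular derivation is ${\mathbf m}(a)=-\operatorname{div}(H_a)$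 (it is a graded Poisson derivation of degree $0$). The Poisson algebra is unimodular if its modular derivation is zero. *)

theory Defs
  imports "HOL-Library.Poly_Mapping"
begin

text \<open>
  The polynomial ring in variables indexed by a finite type \<open>'v\<close>: finitely supported maps from
  exponent vectors to coefficients. The ring structure is the convolution product of
  \<^theory>\<open>HOL-Library.Poly_Mapping\<close>.
\<close>

type_synonym ('v, 'k) mpol = "('v \<Rightarrow>\<^sub>0 nat) \<Rightarrow>\<^sub>0 'k"

definition const :: "'k::field_char_0 \<Rightarrow> ('v::finite, 'k) mpol"
  where "const c = Poly_Mapping.single 0 c"

definition var :: "'v::finite \<Rightarrow> ('v, 'k::field_char_0) mpol"
  where "var i = Poly_Mapping.single (Poly_Mapping.single i 1) 1"

text \<open>
  In \<open>pd\<close>, the subtraction of exponents is truncated, but where truncation takes effect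
  the coefficient \<open>of_nat 0\<close> kills the term.
\<close>

definition pd :: "'v::finite \<Rightarrow> ('v, 'k::field_char_0) mpol \<Rightarrow> ('v, 'k) mpol"
  where "pd i a = (\<Sum>m\<in>Poly_Mapping.keys a.
    Poly_Mapping.single (m - Poly_Mapping.single i 1)
      (of_nat (Poly_Mapping.lookup m i) * Poly_Mapping.lookup a m))"

definition derivation :: "(('v::finite, 'k::field_char_0) mpol \<Rightarrow> ('v, 'k) mpol) \<Rightarrow> bool"
  where "derivation \<phi> \<longleftrightarrow>
    (\<forall>a b. \<phi> (a + b) = \<phi> a + \<phi> b) \<and>
    (\<forall>c a. \<phi> (const c * a) = const c * \<phi> a) \<and>
    (\<forall>a b. \<phi> (a * b) = \<phi> a * b + a * \<phi> b)"

definition divergence :: "(('v::finite, 'k::field_char_0) mpol \<Rightarrow> ('v, 'k) mpol) \<Rightarrow> ('v, 'k) mpol"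
  where "divergence \<phi> = (\<Sum>i\<in>UNIV. pd i (\<phi> (var i)))"

definition wedge ::
    "(('v::finite, 'k::field_char_0) mpol \<Rightarrow> ('v, 'k) mpol) \<Rightarrow> (('v, 'k) mpol \<Rightarrow> ('v, 'k) mpol)
      \<Rightarrow> ('v, 'k) mpol \<Rightarrow> ('v, 'k) mpol \<Rightarrow> ('v, 'k) mpol"
  where "wedge \<phi> \<psi> a b = \<phi> a * \<psi> b - \<psi> a * \<phi> b"


text \<open>
  The grading is given by the degrees \<open>w i\<close> of the variables. The zero polynomial is
  homogeneous of every degree.
\<close>

definition mon_deg :: "('v::finite \<Rightarrow> int) \<Rightarrow> ('v \<Rightarrow>\<^sub>0 nat) \<Rightarrow> int"
  where "mon_deg w m = (\<Sum>i\<in>UNIV. int (Poly_Mapping.lookup m i) * w i)"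

definition homogeneous :: "('v::finite \<Rightarrow> int) \<Rightarrow> int \<Rightarrow> ('v, 'k::field_char_0) mpol \<Rightarrow> bool"
  where "homogeneous w d a \<longleftrightarrow> (\<forall>m\<in>Poly_Mapping.keys a. mon_deg w m = d)"

text \<open>
  The linear extension of \<open>a \<mapsto> \<bar>a\<bar> a\<close> from monomials to all polynomials; see
  \<open>euler_homogeneous\<close> and \<open>derivation_euler\<close> below.
\<close>

definition euler :: "('v::finite \<Rightarrow> int) \<Rightarrow> ('v, 'k::field_char_0) mpol \<Rightarrow> ('v, 'k) mpol"
  where "euler w a = (\<Sum>m\<in>Poly_Mapping.keys a.
    Poly_Mapping.single m (of_int (mon_deg w m) * Poly_Mapping.lookup a m))"


text \<open>Linearity and the Leibniz rule in the first argument follow by skew-symmetry.\<close>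

definition poisson_bracket ::
    "(('v::finite, 'k::field_char_0) mpol \<Rightarrow> ('v, 'k) mpol \<Rightarrow> ('v, 'k) mpol) \<Rightarrow> bool"
  where "poisson_bracket \<pi> \<longleftrightarrow>
    (\<forall>a. derivation (\<pi> a)) \<and>
    (\<forall>a b. \<pi> a b = - \<pi> b a) \<and>
    (\<forall>a b c. \<pi> a (\<pi> b c) + \<pi> b (\<pi> c a) + \<pi> c (\<pi> a b) = 0)"

definition graded_poisson_bracket ::
    "('v::finite \<Rightarrow> int) \<Rightarrow> (('v, 'k::field_char_0) mpol \<Rightarrow> ('v, 'k) mpol \<Rightarrow> ('v, 'k) mpol) \<Rightarrow> bool"
  where "graded_poisson_bracket w \<pi> \<longleftrightarrow> poisson_bracket \<pi> \<and>
    (\<forall>d e a b. homogeneous w d a \<longrightarrow> homogeneous w e b \<longrightarrow> homogeneous w (d + e) (\<pi> a b))"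

definition graded_poisson_derivation ::
    "('v::finite \<Rightarrow> int) \<Rightarrow> (('v, 'k::field_char_0) mpol \<Rightarrow> ('v, 'k) mpol \<Rightarrow> ('v, 'k) mpol)
      \<Rightarrow> (('v, 'k) mpol \<Rightarrow> ('v, 'k) mpol) \<Rightarrow> bool"
  where "graded_poisson_derivation w \<pi> \<delta> \<longleftrightarrow> derivation \<delta> \<and>
    (\<forall>a b. \<delta> (\<pi> a b) = \<pi> (\<delta> a) b + \<pi> a (\<delta> b)) \<and>
    (\<forall>d a. homogeneous w d a \<longrightarrow> homogeneous w d (\<delta> a))"

text \<open>
  The bracket of the graded twist. It is only meaningful as such when \<open>\<delta>\<close> satisfies
  \<^term>\<open>graded_poisson_derivation w \<pi> \<delta>\<close>.
\<close>

definition graded_twist ::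
    "('v::finite \<Rightarrow> int) \<Rightarrow> (('v, 'k::field_char_0) mpol \<Rightarrow> ('v, 'k) mpol \<Rightarrow> ('v, 'k) mpol)
      \<Rightarrow> (('v, 'k) mpol \<Rightarrow> ('v, 'k) mpol) \<Rightarrow> ('v, 'k) mpol \<Rightarrow> ('v, 'k) mpol \<Rightarrow> ('v, 'k) mpol"
  where "graded_twist w \<pi> \<delta> a b = \<pi> a b + wedge (euler w) \<delta> a b"

definition hamiltonian ::
    "(('v::finite, 'k::field_char_0) mpol \<Rightarrow> ('v, 'k) mpol \<Rightarrow> ('v, 'k) mpol)
      \<Rightarrow> ('v, 'k) mpol \<Rightarrow> ('v, 'k) mpol \<Rightarrow> ('v, 'k) mpol"
  where "hamiltonian \<pi> a = (\<lambda>b. \<pi> a b)"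

definition modular ::
    "(('v::finite, 'k::field_char_0) mpol \<Rightarrow> ('v, 'k) mpol \<Rightarrow> ('v, 'k) mpol)
      \<Rightarrow> ('v, 'k) mpol \<Rightarrow> ('v, 'k) mpol"
  where "modular \<pi> a = - divergence (hamiltonian \<pi> a)"

definition unimodular ::
    "(('v::finite, 'k::field_char_0) mpol \<Rightarrow> ('v, 'k) mpol \<Rightarrow> ('v, 'k) mpol) \<Rightarrow> bool"
  where "unimodular \<pi> \<longleftrightarrow> (\<forall>a. modular \<pi> a = 0)"


lemma lookup_const_mult:
  "Poly_Mapping.lookup (const c * a) m = c * Poly_Mapping.lookup a m"
proof -
  have "const c * a = Poly_Mapping.map ((*) c) a"
    unfolding const_def by (rule mult_map_scale_conv_mult[symmetric])
  then show ?thesis by (simp add: Poly_Mapping.map.rep_eq when_def)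
qed

lemma lookup_euler:
  "Poly_Mapping.lookup (euler w a) m = of_int (mon_deg w m) * Poly_Mapping.lookup a m"
  by (auto simp: euler_def lookup_sum lookup_single when_def in_keys_iff)

lemma euler_homogeneous: "homogeneous w d a \<Longrightarrow> euler w a = const (of_int d) * a"
  by (rule poly_mapping_eqI)
    (auto simp: lookup_euler lookup_const_mult homogeneous_def in_keys_iff)

lemma mon_deg_add: "mon_deg w (m + m') = mon_deg w m + mon_deg w m'"
  by (simp add: mon_deg_def lookup_add sum.distrib algebra_simps)

lemma euler_add: "euler w (a + b) = euler w a + euler w b"
  by (rule poly_mapping_eqI) (simp add: lookup_euler lookup_add algebra_simps)

lemma euler_single:
  "euler w (Poly_Mapping.single m c) = Poly_Mapping.single m (of_int (mon_deg w m) * c)"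
  by (rule poly_mapping_eqI) (simp add: lookup_euler lookup_single when_def)

lemma poly_mapping_add_induct:
  fixes a :: "'a \<Rightarrow>\<^sub>0 'b::comm_monoid_add"
  assumes "\<And>m c. P (Poly_Mapping.single m c)" and "\<And>a b. P a \<Longrightarrow> P b \<Longrightarrow> P (a + b)"
  shows "P a"
proof -
  have *: "P 0" using assms(1)[of undefined 0] by simp
  have "P (\<Sum>m\<in>S. Poly_Mapping.single m (Poly_Mapping.lookup a m))" for S
    by (induction S rule: infinite_finite_induct) (auto simp: * assms)
  moreover have "(\<Sum>m\<in>Poly_Mapping.keys a. Poly_Mapping.single m (Poly_Mapping.lookup a m)) = a"
    by (rule poly_mapping_eqI) (auto simp: lookup_sum lookup_single when_def in_keys_iff)
  ultimately show ?thesis by metis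
qed

lemma derivationI:
  fixes \<phi> :: "('v::finite, 'k::field_char_0) mpol \<Rightarrow> ('v, 'k) mpol"
  assumes add: "\<And>a b. \<phi> (a + b) = \<phi> a + \<phi> b"
    and scale: "\<And>c a. \<phi> (const c * a) = const c * \<phi> a"
    and leibniz: "\<And>m c m' c'. \<phi> (Poly_Mapping.single m c * Poly_Mapping.single m' c') =
      \<phi> (Poly_Mapping.single m c) * Poly_Mapping.single m' c' +
      Poly_Mapping.single m c * \<phi> (Poly_Mapping.single m' c')"
  shows "derivation \<phi>"
proof -
  have "\<phi> (a * b) = \<phi> a * b + a * \<phi> b" for a b
  proof (induction a rule: poly_mapping_add_induct)
    case (1 m c)
    show ?case
      by (induction b rule: poly_mapping_add_induct) (simp_all add: add leibniz distrib_left)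
  qed (simp add: add algebra_simps)
  then show ?thesis unfolding derivation_def using add scale by blast
qed

lemma derivation_euler: "derivation (euler w)"
proof (rule derivationI)
  show "euler w (const c * a) = const c * euler w a" for c a
    by (rule poly_mapping_eqI) (simp add: lookup_euler lookup_const_mult)
qed (simp_all add: euler_add euler_single mult_single mon_deg_add
      algebra_simps flip: single_add)

lemma pd_superset:
  assumes "finite S" "Poly_Mapping.keys a \<subseteq> S"
  shows "pd i a = (\<Sum>m\<in>S. Poly_Mapping.single (m - Poly_Mapping.single i 1)
      (of_nat (Poly_Mapping.lookup m i) * Poly_Mapping.lookup a m))"
  unfolding pd_def by (rule sum.mono_neutral_left) (use assms in \<open>auto simp: in_keys_iff\<close>)

lemma pd_add: "pd i (a + b) = pd i a + pd i b"
proof -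
  let ?S = "Poly_Mapping.keys a \<union> Poly_Mapping.keys b"
  have "Poly_Mapping.keys (a + b) \<subseteq> ?S" by (rule Poly_Mapping.keys_add)
  then show ?thesis
    by (simp add: pd_superset[where S = ?S] lookup_add sum.distrib distrib_left single_add)
qed

lemma pd_single:
  "pd i (Poly_Mapping.single m c) =
    Poly_Mapping.single (m - Poly_Mapping.single i 1) (of_nat (Poly_Mapping.lookup m i) * c)"
  by (subst pd_superset[where S = "{m}"]) auto

lemma pd_var: "pd i (var j) = (if i = j then 1 else 0)"
  by (auto simp: var_def pd_single lookup_single single_one)

lemma minus_single_add:
  fixes m m' :: "'v \<Rightarrow>\<^sub>0 nat"
  assumes "Poly_Mapping.lookup m i \<noteq> 0"
  shows "(m - Poly_Mapping.single i 1) + m' = m + m' - Poly_Mapping.single i 1"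
  by (rule poly_mapping_eqI)
    (use assms in \<open>auto simp: lookup_add lookup_minus lookup_single when_def\<close>)

lemma derivation_pd: "derivation (pd i)"
proof (rule derivationI)
  show "pd i (const c * a) = const c * pd i a" for c a
    by (induction a rule: poly_mapping_add_induct)
      (simp_all add: const_def pd_add pd_single mult_single distrib_left mult.left_commute)
next
  fix m m' :: "'a \<Rightarrow>\<^sub>0 nat" and c c' :: 'b
  let ?x = "Poly_Mapping.single i (1::nat)"
  let ?e = "of_nat (Poly_Mapping.lookup m i) :: 'b"
  let ?e' = "of_nat (Poly_Mapping.lookup m' i) :: 'b"
  have 1: "Poly_Mapping.single (m - ?x + m') (?e * c * c')
      = Poly_Mapping.single (m + m' - ?x) (?e * c * c')"
    using minus_single_add[of m i m'] by (cases "Poly_Mapping.lookup m i = 0") auto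
  have 2: "Poly_Mapping.single (m + (m' - ?x)) (c * (?e' * c'))
      = Poly_Mapping.single (m + m' - ?x) (c * (?e' * c'))"
    using minus_single_add[of m' i m]
    by (cases "Poly_Mapping.lookup m' i = 0") (auto simp: add.commute)
  show "pd i (Poly_Mapping.single m c * Poly_Mapping.single m' c') =
      pd i (Poly_Mapping.single m c) * Poly_Mapping.single m' c' +
      Poly_Mapping.single m c * pd i (Poly_Mapping.single m' c')"
    unfolding pd_single mult_single 1 2
    by (simp add: lookup_add algebra_simps flip: single_add)
qed (rule pd_add)

end

theory Submission
  imports Defs
begin

text \<open>
  The twisted Hamiltonian field is \<open>H\<^sub>a + E(a) \<delta> - \<delta>(a) E\<close>. By
  \<open>div (a \<phi>) = a div \<phi> + \<phi>(a)\<close>, and because \<open>\<delta>\<close> has degree 0 and therefore commutes with \<open>E\<close>,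
  its divergence is \<open>-m(a) + E(a) div \<delta> - \<delta>(a) div E\<close>. Here \<open>div E\<close> is the sum of the degrees
  of the variables, so for the chosen \<open>\<delta>\<close> the outer terms cancel, and \<open>div m = 0\<close> because
  the matrix of brackets of the variables is skew-symmetric while that of second partial
  derivatives is symmetric.

  That \<open>m\<close> is a Poisson derivation follows from \<open>div [\<phi>, \<psi>] = \<phi>(div \<psi>) - \<psi>(div \<phi>)\<close>
  and the Jacobi identity \<open>H\<^bsub>{a, b}\<^esub> = [H\<^sub>a, H\<^sub>b]\<close>.
\<close>

subsection \<open>Derivations of the polynomial ring\<close>

lemma const_add: "const (c + d) = const c + const d"
  by (simp add: const_def single_add)

lemma const_mult: "const (c * d) = const c * const d"
  by (simp add: const_def mult_single)

lemma const_0 [simp]: "const 0 = 0"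
  by (simp add: const_def)

lemma const_1 [simp]: "const 1 = 1"
  by (simp add: const_def)

lemma const_uminus: "const (- c) = - const c"
  by (simp add: const_def single_uminus)

lemma single_eq_const_mult: "Poly_Mapping.single m c = const c * Poly_Mapping.single m 1"
  by (simp add: const_def mult_single)

text \<open>Characteristic zero permits cancelling the factor 2 in each coefficient. This is the
  last step of the skew-symmetry argument in \<open>divergence_modular\<close>.\<close>

lemma eq_uminus_self:
  fixes a :: "'a \<Rightarrow>\<^sub>0 'k::field_char_0"
  assumes "a = - a"
  shows "a = 0"
proof (rule poly_mapping_eqI)
  fix m
  have "Poly_Mapping.lookup a m = - Poly_Mapping.lookup a m"
    by (subst assms) simp
  then have "2 * Poly_Mapping.lookup a m = 0"
    by (simp only: mult_2 eq_neg_iff_add_eq_0)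
  then show "Poly_Mapping.lookup a m = Poly_Mapping.lookup 0 m"
    by simp
qed

lemma const_of_int_sum: "const (of_int (\<Sum>i\<in>S. f i)) = (\<Sum>i\<in>S. const (of_int (f i)))"
  by (induction S rule: infinite_finite_induct) (simp_all add: const_add)

context
  fixes \<phi> :: "('v::finite, 'k::field_char_0) mpol \<Rightarrow> ('v, 'k) mpol"
  assumes \<phi>: "derivation \<phi>"
begin

lemma derivation_add: "\<phi> (a + b) = \<phi> a + \<phi> b"
  using \<phi> by (simp add: derivation_def)

lemma derivation_scale: "\<phi> (const c * a) = const c * \<phi> a"
  using \<phi> unfolding derivation_def by blast

lemma derivation_mult: "\<phi> (a * b) = \<phi> a * b + a * \<phi> b"
  using \<phi> by (simp add: derivation_def)

lemma derivation_0: "\<phi> 0 = 0"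
  using derivation_add[of 0 0] by simp

lemma derivation_uminus: "\<phi> (- a) = - \<phi> a"
  using derivation_add[of a "- a"] by (simp add: derivation_0 eq_neg_iff_add_eq_0 add.commute)

lemma derivation_diff: "\<phi> (a - b) = \<phi> a - \<phi> b"
  using derivation_add[of a "- b"] by (simp add: derivation_uminus)

lemma derivation_sum: "\<phi> (\<Sum>i\<in>S. f i) = (\<Sum>i\<in>S. \<phi> (f i))"
  by (induction S rule: infinite_finite_induct) (simp_all add: derivation_0 derivation_add)

lemma derivation_1: "\<phi> 1 = 0"
  using derivation_mult[of 1 1] by simp

lemma derivation_const: "\<phi> (const c) = 0"
  using derivation_scale[of c 1] by (simp add: derivation_1)

end

text \<open>The Leibniz rule carries the equality from the variables to all monomials with
  coefficient 1, and linearity over constants carries it to all polynomials.\<close>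

lemma derivation_eqI:
  fixes \<phi> \<psi> :: "('v::finite, 'k::field_char_0) mpol \<Rightarrow> ('v, 'k) mpol"
  assumes \<phi>: "derivation \<phi>" and \<psi>: "derivation \<psi>" and eq: "\<And>i. \<phi> (var i) = \<psi> (var i)"
  shows "\<phi> = \<psi>"
proof
  have mono: "\<phi> (Poly_Mapping.single m 1) = \<psi> (Poly_Mapping.single m 1)" for m
  \<comment> \<open>An exponent vector is itself a finitely supported map, so the additive induction
    principle for polynomials applies to \<open>m\<close> as well. Its base case is a power of one
    variable.\<close>
  proof (induction m rule: poly_mapping_add_induct)
    case (1 i n)
    show ?case
    proof (induction n)
      case 0
      then show ?case by (simp add: derivation_1[OF \<phi>] derivation_1[OF \<psi>])
    next
      case (Suc n)
      have "Poly_Mapping.single (Poly_Mapping.single i (Suc n)) (1::'k) =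
          var i * Poly_Mapping.single (Poly_Mapping.single i n) 1"
        by (simp add: var_def mult_single flip: single_add)
      with Suc show ?case
        by (simp add: derivation_mult[OF \<phi>] derivation_mult[OF \<psi>] eq)
    qed
  next
    case (2 m m')
    have "Poly_Mapping.single (m + m') (1::'k) = Poly_Mapping.single m 1 * Poly_Mapping.single m' 1"
      by (simp add: mult_single)
    with 2 show ?case
      by (simp add: derivation_mult[OF \<phi>] derivation_mult[OF \<psi>])
  qed
  show "\<phi> a = \<psi> a" for a
  proof (induction a rule: poly_mapping_add_induct)
    case (1 m c)
    show ?case
      by (subst (1 2) single_eq_const_mult)
        (simp add: derivation_scale[OF \<phi>] derivation_scale[OF \<psi>] mono)
  qed (simp add: derivation_add[OF \<phi>] derivation_add[OF \<psi>])
qed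

lemma derivation_plus:
  assumes "derivation \<phi>" "derivation \<psi>"
  shows "derivation (\<lambda>b. \<phi> b + \<psi> b)"
  unfolding derivation_def
  by (simp add: derivation_add[OF assms(1)] derivation_add[OF assms(2)]
      derivation_const[OF assms(1)] derivation_const[OF assms(2)]
      derivation_mult[OF assms(1)] derivation_mult[OF assms(2)] distrib_left distrib_right)

lemma derivation_times:
  assumes "derivation \<phi>"
  shows "derivation (\<lambda>b. a * \<phi> b)"
  unfolding derivation_def
  by (simp add: derivation_add[OF assms] derivation_const[OF assms] derivation_mult[OF assms]
      distrib_left mult_ac)

lemma derivation_minus:
  assumes "derivation \<phi>" "derivation \<psi>"
  shows "derivation (\<lambda>b. \<phi> b - \<psi> b)"
  unfolding derivation_def
  by (simp add: derivation_add[OF assms(1)] derivation_add[OF assms(2)]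
      derivation_const[OF assms(1)] derivation_const[OF assms(2)]
      derivation_mult[OF assms(1)] derivation_mult[OF assms(2)]
      left_diff_distrib right_diff_distrib)

lemma derivation_sumI: "(\<And>i. derivation (f i)) \<Longrightarrow> derivation (\<lambda>b. \<Sum>i\<in>S. f i b)"
  by (induction S rule: infinite_finite_induct)
    (simp_all add: derivation_plus, simp_all add: derivation_def)

text \<open>In the Leibniz expansion the mixed terms \<open>\<phi> a * \<psi> b\<close> and
  \<open>\<psi> a * \<phi> b\<close> occur in both compositions and cancel.\<close>

lemma derivation_commutator:
  assumes "derivation \<phi>" "derivation \<psi>"
  shows "derivation (\<lambda>b. \<phi> (\<psi> b) - \<psi> (\<phi> b))"
  unfolding derivation_def
  by (simp add: derivation_add[OF assms(1)] derivation_add[OF assms(2)]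
      derivation_const[OF assms(1)] derivation_const[OF assms(2)]
      derivation_0[OF assms(1)] derivation_0[OF assms(2)]
      derivation_mult[OF assms(1)] derivation_mult[OF assms(2)]
      left_diff_distrib right_diff_distrib distrib_left distrib_right)

text \<open>Both sides are derivations in \<open>b\<close> with the same values on the variables.
  This is the coordinate form of a polynomial vector field.\<close>

lemma derivation_expand:
  assumes "derivation \<phi>"
  shows "\<phi> b = (\<Sum>i\<in>UNIV. pd i b * \<phi> (var i))"
proof -
  have "derivation (\<lambda>b. \<Sum>i\<in>UNIV. pd i b * \<phi> (var i))"
    by (subst mult.commute) (intro derivation_sumI derivation_times derivation_pd)
  then have "\<phi> = (\<lambda>b. \<Sum>i\<in>UNIV. pd i b * \<phi> (var i))"
    by (rule derivation_eqI[OF assms]) (simp add: pd_var if_distrib[of "\<lambda>x. x * _"] cong: if_cong)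
  then show ?thesis by meson
qed

text \<open>The commutator of \<open>pd i\<close> and \<open>\<phi>\<close> is a derivation. Since
  \<open>pd i (var j)\<close> is 0 or 1 and thus killed by \<open>\<phi>\<close>, it sends
  \<open>var j\<close> to \<open>pd i (\<phi> (var j))\<close>, and its coordinate expansion is the
  correction sum.\<close>

lemma pd_derivation:
  assumes "derivation \<phi>"
  shows "pd i (\<phi> b) = \<phi> (pd i b) + (\<Sum>j\<in>UNIV. pd j b * pd i (\<phi> (var j)))"
proof -
  have "\<phi> (pd i (var j)) = 0" for j
    by (simp add: pd_var derivation_0[OF assms] derivation_1[OF assms])
  with derivation_expand[OF derivation_commutator[OF derivation_pd[of i] assms], of b]
  show ?thesis by (simp add: algebra_simps)
qed

text \<open>Partial derivatives of variables are constants, so the correction sum of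
  \<open>pd_derivation\<close> vanishes.\<close>

lemma pd_commute: "pd i (pd j a) = pd j (pd i a)"
  using pd_derivation[OF derivation_pd[of j], of i a]
  by (simp add: pd_var if_distrib[of "pd i"] derivation_0[OF derivation_pd]
      derivation_1[OF derivation_pd] cong: if_cong)

subsection \<open>Divergence\<close>

lemma divergence_plus: "divergence (\<lambda>b. \<phi> b + \<psi> b) = divergence \<phi> + divergence \<psi>"
  by (simp add: divergence_def derivation_add[OF derivation_pd] sum.distrib)

lemma divergence_minus: "divergence (\<lambda>b. \<phi> b - \<psi> b) = divergence \<phi> - divergence \<psi>"
  by (simp add: divergence_def derivation_diff[OF derivation_pd] sum_subtractf)

text \<open>The product rule leaves the extra sum of \<open>pd i a * \<phi> (var i)\<close>, which
  is the coordinate expansion of \<open>\<phi> a\<close>.\<close>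

lemma divergence_times:
  assumes "derivation \<phi>"
  shows "divergence (\<lambda>b. a * \<phi> b) = a * divergence \<phi> + \<phi> a"
  by (simp add: divergence_def derivation_mult[OF derivation_pd] sum.distrib sum_distrib_left
      derivation_expand[OF assms, of a] add.commute)

text \<open>Moving partial derivatives past \<open>\<phi>\<close> and \<open>\<psi>\<close> with
  \<open>pd_derivation\<close> leaves two double sums. They are the traces of the two products of
  the Jacobian matrices of \<open>\<phi>\<close> and \<open>\<psi>\<close>, hence equal.\<close>

lemma divergence_commutator:
  assumes \<phi>: "derivation \<phi>" and \<psi>: "derivation \<psi>"
  shows "divergence (\<lambda>b. \<phi> (\<psi> b) - \<psi> (\<phi> b)) = \<phi> (divergence \<psi>) - \<psi> (divergence \<phi>)"
proof -
  have "divergence (\<lambda>b. \<phi> (\<psi> b)) = \<phi> (divergence \<psi>) +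
      (\<Sum>i\<in>UNIV. \<Sum>j\<in>UNIV. pd j (\<psi> (var i)) * pd i (\<phi> (var j)))"
    by (simp add: divergence_def pd_derivation[OF \<phi>, of _ "\<psi> x" for x]
        derivation_sum[OF \<phi>] sum.distrib)
  moreover have "divergence (\<lambda>b. \<psi> (\<phi> b)) = \<psi> (divergence \<phi>) +
      (\<Sum>i\<in>UNIV. \<Sum>j\<in>UNIV. pd j (\<phi> (var i)) * pd i (\<psi> (var j)))"
    by (simp add: divergence_def pd_derivation[OF \<psi>, of _ "\<phi> x" for x]
        derivation_sum[OF \<psi>] sum.distrib)
  moreover have "(\<Sum>i\<in>UNIV. \<Sum>j\<in>UNIV. pd j (\<psi> (var i)) * pd i (\<phi> (var j))) =
      (\<Sum>i\<in>UNIV. \<Sum>j\<in>UNIV. pd j (\<phi> (var i)) * pd i (\<psi> (var j)))"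
    by (subst sum.swap) (simp add: mult.commute)
  ultimately show ?thesis by (simp add: divergence_minus)
qed

subsection \<open>Homogeneous polynomials\<close>

lemma mon_deg_single: "mon_deg w (Poly_Mapping.single i n) = int n * w i"
proof -
  have "mon_deg w (Poly_Mapping.single i n) = (\<Sum>j\<in>UNIV. if i = j then int n * w i else 0)"
    unfolding mon_deg_def by (rule sum.cong) (auto simp: lookup_single)
  then show ?thesis by simp
qed

lemma homogeneous_0 [simp]: "homogeneous w d 0"
  by (simp add: homogeneous_def)

lemma homogeneous_add:
  "homogeneous w d a \<Longrightarrow> homogeneous w d b \<Longrightarrow> homogeneous w d (a + b)"
  using Poly_Mapping.keys_add[of a b] by (auto simp: homogeneous_def)

lemma homogeneous_uminus: "homogeneous w d a \<Longrightarrow> homogeneous w d (- a)"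
  by (simp add: homogeneous_def)

lemma homogeneous_diff:
  "homogeneous w d a \<Longrightarrow> homogeneous w d b \<Longrightarrow> homogeneous w d (a - b)"
  using homogeneous_add[of w d a "- b"] by (simp add: homogeneous_uminus)

lemma homogeneous_sum:
  "(\<And>i. i \<in> S \<Longrightarrow> homogeneous w d (f i)) \<Longrightarrow> homogeneous w d (\<Sum>i\<in>S. f i)"
  by (induction S rule: infinite_finite_induct) (simp_all add: homogeneous_add)

lemma homogeneous_mult:
  assumes "homogeneous w d a" "homogeneous w e b"
  shows "homogeneous w (d + e) (a * b)"
  unfolding homogeneous_def
proof
  fix m
  assume "m \<in> Poly_Mapping.keys (a * b)"
  then obtain m1 m2 where "m = m1 + m2" "m1 \<in> Poly_Mapping.keys a" "m2 \<in> Poly_Mapping.keys b"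
    using keys_mult[of a b] by blast
  with assms show "mon_deg w m = d + e" by (simp add: homogeneous_def mon_deg_add)
qed

lemma homogeneous_single: "homogeneous w (mon_deg w m) (Poly_Mapping.single m c)"
  by (simp add: homogeneous_def)

lemma homogeneous_scale: "homogeneous w d a \<Longrightarrow> homogeneous w d (const c * a)"
  using homogeneous_mult[of w 0 "const c" d a] homogeneous_single[of w 0 c]
  by (simp add: const_def mon_deg_def)

lemma homogeneous_var: "homogeneous w (w i) (var i)"
  using homogeneous_single[of w "Poly_Mapping.single i 1" 1] by (simp add: var_def mon_deg_single)

lemma homogeneous_euler: "homogeneous w d a \<Longrightarrow> homogeneous w d (euler w a)"
  by (simp add: euler_homogeneous homogeneous_scale)

lemma homogeneous_pd:
  assumes "homogeneous w d a"
  shows "homogeneous w (d - w i) (pd i a)"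
  unfolding pd_def
proof (rule homogeneous_sum)
  fix m
  assume m: "m \<in> Poly_Mapping.keys a"
  let ?x = "Poly_Mapping.single i (1::nat)"
  show "homogeneous w (d - w i) (Poly_Mapping.single (m - ?x)
      (of_nat (Poly_Mapping.lookup m i) * Poly_Mapping.lookup a m))"
  \<comment> \<open>For exponent 0 the truncated subtraction does not lower the degree, but the
    coefficient is 0 and the zero polynomial has every degree.\<close>
  proof (cases "Poly_Mapping.lookup m i = 0")
    case False
    then have "m = (m - ?x) + ?x"
      by (intro poly_mapping_eqI) (auto simp: lookup_add lookup_minus lookup_single when_def)
    then have "mon_deg w m = mon_deg w (m - ?x) + w i"
      by (metis mon_deg_add mon_deg_single mult_1 of_nat_1)
    moreover have "mon_deg w m = d" using m assms by (simp add: homogeneous_def)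
    ultimately show ?thesis
      using homogeneous_single[of w "m - ?x"] by (metis add_diff_cancel_right')
  qed simp
qed

text \<open>Differentiating by \<open>var i\<close> removes exactly the \<open>w i\<close> that a
  map of degree \<open>d\<close> adds to \<open>d\<close> on \<open>var i\<close>.\<close>

lemma homogeneous_divergence:
  assumes "\<And>i. homogeneous w (d + w i) (\<phi> (var i))"
  shows "homogeneous w d (divergence \<phi>)"
  unfolding divergence_def
proof (rule homogeneous_sum)
  show "homogeneous w d (pd i (\<phi> (var i)))" for i
    using homogeneous_pd[OF assms[of i], of i] by simp
qed

text \<open>The Euler derivation is the vector field with coefficients \<open>w i\<close> times
  \<open>var i\<close>, so each index contributes the constant \<open>w i\<close>.\<close>

lemma divergence_euler:
  fixes w :: "'v::finite \<Rightarrow> int"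
  shows "divergence (euler w) = (const (of_int (\<Sum>i\<in>UNIV. w i)) :: ('v, 'k::field_char_0) mpol)"
proof -
  have "euler w (var i) = const (of_int (w i)) * (var i :: ('v, 'k::field_char_0) mpol)" for i
    by (rule euler_homogeneous[OF homogeneous_var])
  then have "divergence (euler w) = (\<Sum>i\<in>UNIV. const (of_int (w i)) :: ('v, 'k) mpol)"
    by (simp add: divergence_def derivation_scale[OF derivation_pd] pd_var)
  then show ?thesis
    by (simp only: const_of_int_sum)
qed

text \<open>On a monomial the Euler derivation is multiplication by its degree, and
  \<open>\<delta>\<close> keeps that degree.\<close>

lemma euler_commute:
  assumes "derivation \<delta>" "\<And>d a. homogeneous w d a \<Longrightarrow> homogeneous w d (\<delta> a)"
  shows "euler w (\<delta> a) = \<delta> (euler w a)"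
proof (induction a rule: poly_mapping_add_induct)
  case (1 m c)
  have "homogeneous w (mon_deg w m) (\<delta> (Poly_Mapping.single m c))"
    by (intro assms(2) homogeneous_single)
  then show ?case
    by (simp add: euler_homogeneous euler_homogeneous[OF homogeneous_single]
        derivation_scale[OF assms(1)])
qed (simp add: derivation_add[OF assms(1)] euler_add)

subsection \<open>The modular derivation\<close>

context
  fixes \<pi> :: "('v::finite, 'k::field_char_0) mpol \<Rightarrow> ('v, 'k) mpol \<Rightarrow> ('v, 'k) mpol"
  assumes \<pi>: "poisson_bracket \<pi>"
begin

lemma poisson_derivation: "derivation (\<pi> a)"
  using \<pi> unfolding poisson_bracket_def by blast

lemma poisson_skew: "\<pi> a b = - \<pi> b a"
  using \<pi> unfolding poisson_bracket_def by blast

lemma poisson_jacobi: "\<pi> a (\<pi> b c) + \<pi> b (\<pi> c a) + \<pi> c (\<pi> a b) = 0"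
  using \<pi> unfolding poisson_bracket_def by blast

lemma poisson_add: "\<pi> (a + b) c = \<pi> a c + \<pi> b c"
  by (simp add: poisson_skew[of "a + b" c] poisson_skew[of a c] poisson_skew[of b c]
      derivation_add[OF poisson_derivation])

lemma poisson_scale: "\<pi> (const k * a) c = const k * \<pi> a c"
  by (simp add: poisson_skew[of "const k * a" c] poisson_skew[of a c]
      derivation_scale[OF poisson_derivation])

lemma poisson_mult: "\<pi> (a * b) c = a * \<pi> b c + b * \<pi> a c"
  by (simp add: poisson_skew[of "a * b" c] poisson_skew[of a c] poisson_skew[of b c]
      derivation_mult[OF poisson_derivation] algebra_simps)

text \<open>The Jacobi identity as a commutator of Hamiltonian derivations, the form to which
  \<open>divergence_commutator\<close> applies.\<close>

lemma poisson_commutator: "\<pi> (\<pi> a b) c = \<pi> a (\<pi> b c) - \<pi> b (\<pi> a c)"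
proof -
  have "\<pi> b (\<pi> c a) = - \<pi> b (\<pi> a c)"
    using poisson_skew[of c a] by (simp add: derivation_uminus[OF poisson_derivation])
  then show ?thesis
    using poisson_jacobi[of a b c] poisson_skew[of "\<pi> a b" c] by (simp add: algebra_simps)
qed

lemma modular_eq: "modular \<pi> a = - divergence (\<pi> a)"
  by (simp add: modular_def hamiltonian_def)

lemma derivation_modular: "derivation (modular \<pi>)"
  unfolding derivation_def
proof (intro conjI allI)
  fix a b c
  note div_times = divergence_times[OF poisson_derivation]
  have "\<pi> (a + b) = (\<lambda>x. \<pi> a x + \<pi> b x)"
    by (rule ext) (rule poisson_add)
  then show "modular \<pi> (a + b) = modular \<pi> a + modular \<pi> b"
    by (simp add: modular_eq divergence_plus)
  have "\<pi> (const c * a) = (\<lambda>x. const c * \<pi> a x)"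
    by (rule ext) (rule poisson_scale)
  then show "modular \<pi> (const c * a) = const c * modular \<pi> a"
    by (simp add: modular_eq div_times derivation_const[OF poisson_derivation])
  have "\<pi> (a * b) = (\<lambda>x. a * \<pi> b x + b * \<pi> a x)"
    by (rule ext) (rule poisson_mult)
  \<comment> \<open>The two extra terms \<open>\<pi> b a\<close> and \<open>\<pi> a b\<close> from
    \<open>divergence_times\<close> cancel by skew-symmetry, which makes the modular map a
    derivation.\<close>
  then have "divergence (\<pi> (a * b)) =
      (a * divergence (\<pi> b) + \<pi> b a) + (b * divergence (\<pi> a) + \<pi> a b)"
    by (simp only: divergence_plus div_times)
  then show "modular \<pi> (a * b) = modular \<pi> a * b + a * modular \<pi> b"
    by (simp add: modular_eq poisson_skew[of a b] algebra_simps)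
qed

lemma modular_poisson: "modular \<pi> (\<pi> a b) = \<pi> (modular \<pi> a) b + \<pi> a (modular \<pi> b)"
proof -
  have "\<pi> (\<pi> a b) = (\<lambda>c. \<pi> a (\<pi> b c) - \<pi> b (\<pi> a c))"
    by (rule ext) (rule poisson_commutator)
  then have "divergence (\<pi> (\<pi> a b)) = \<pi> a (divergence (\<pi> b)) - \<pi> b (divergence (\<pi> a))"
    by (simp only: divergence_commutator[OF poisson_derivation poisson_derivation])
  then show ?thesis
    by (simp add: modular_eq poisson_skew[of "- divergence (\<pi> a)" b]
        derivation_uminus[OF poisson_derivation])
qed

lemma divergence_modular: "divergence (modular \<pi>) = 0"
proof -
  \<comment> \<open>The divergence of \<open>modular \<pi>\<close> is \<open>- ?s\<close>.
    Exchanging the two indices shows that \<open>?s\<close> equals its own negative.\<close>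
  let ?s = "\<Sum>i\<in>UNIV. \<Sum>j\<in>UNIV. pd i (pd j (\<pi> (var i) (var j)))"
  have "?s = (\<Sum>i\<in>UNIV. \<Sum>j\<in>UNIV. pd j (pd i (\<pi> (var j) (var i))))"
    by (rule sum.swap)
  also have "\<dots> = (\<Sum>i\<in>UNIV. \<Sum>j\<in>UNIV. - pd i (pd j (\<pi> (var i) (var j))))"
  proof (intro sum.cong refl)
    show "pd j (pd i (\<pi> (var j) (var i))) = - pd i (pd j (\<pi> (var i) (var j)))" for i j
      unfolding poisson_skew[of "var j" "var i"] derivation_uminus[OF derivation_pd]
      by (simp only: pd_commute[of j i])
  qed
  also have "\<dots> = - ?s"
    by (simp only: sum_negf)
  finally have "?s = 0"
    by (rule eq_uminus_self)
  then show ?thesis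
    by (simp add: divergence_def modular_eq derivation_uminus[OF derivation_pd]
        derivation_sum[OF derivation_pd] sum_negf)
qed

end

lemma homogeneous_bracket:
  "graded_poisson_bracket w \<pi> \<Longrightarrow> homogeneous w d a \<Longrightarrow> homogeneous w e b \<Longrightarrow>
    homogeneous w (d + e) (\<pi> a b)"
  unfolding graded_poisson_bracket_def by blast

lemma homogeneous_modular:
  assumes "graded_poisson_bracket w \<pi>" "homogeneous w d a"
  shows "homogeneous w d (modular \<pi> a)"
  unfolding modular_def hamiltonian_def
  by (intro homogeneous_uminus homogeneous_divergence homogeneous_bracket[OF assms]
      homogeneous_var)

subsection \<open>Graded twists\<close>

lemma graded_poisson_derivation_scale:
  assumes "poisson_bracket \<pi>" "graded_poisson_derivation w \<pi> \<delta>"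
  shows "graded_poisson_derivation w \<pi> (\<lambda>a. const c * \<delta> a)"
  using assms
  by (auto simp: graded_poisson_derivation_def derivation_times homogeneous_scale
      poisson_scale derivation_scale[OF poisson_derivation] algebra_simps)

text \<open>On monomials both sides multiply the bracket by the sum of the two degrees, because the
  bracket has degree 0. Biadditivity does the rest.\<close>

lemma euler_poisson:
  assumes "graded_poisson_bracket w \<pi>"
  shows "euler w (\<pi> a b) = \<pi> (euler w a) b + \<pi> a (euler w b)"
proof -
  have \<pi>: "poisson_bracket \<pi>" using assms by (simp add: graded_poisson_bracket_def)
  note lin = poisson_add[OF \<pi>] derivation_add[OF poisson_derivation[OF \<pi>]] euler_add
  show ?thesis
  proof (induction a rule: poly_mapping_add_induct)
    case (1 m c)
    show ?case
    proof (induction b rule: poly_mapping_add_induct)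
      case (1 m' c')
      have "homogeneous w (mon_deg w m + mon_deg w m')
          (\<pi> (Poly_Mapping.single m c) (Poly_Mapping.single m' c'))"
        by (intro homogeneous_bracket[OF assms] homogeneous_single)
      then show ?case
        by (simp add: euler_homogeneous euler_homogeneous[OF homogeneous_single]
            poisson_scale[OF \<pi>] derivation_scale[OF poisson_derivation[OF \<pi>]] const_add distrib_right)
    qed (simp add: lin algebra_simps)
  qed (simp add: lin algebra_simps)
qed

text \<open>The Jacobi sum splits by the number of wedge factors. The part without wedge is the
  Jacobi identity of \<open>\<pi>\<close>, the mixed part vanishes because \<open>\<phi>\<close> and
  \<open>\<psi>\<close> are Poisson derivations, and the pure wedge part because they
  commute.\<close>

lemma poisson_bracket_wedge:
  assumes \<pi>: "poisson_bracket \<pi>"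
    and \<phi>: "derivation \<phi>" "\<And>a b. \<phi> (\<pi> a b) = \<pi> (\<phi> a) b + \<pi> a (\<phi> b)"
    and \<psi>: "derivation \<psi>" "\<And>a b. \<psi> (\<pi> a b) = \<pi> (\<psi> a) b + \<pi> a (\<psi> b)"
    and comm: "\<And>a. \<phi> (\<psi> a) = \<psi> (\<phi> a)"
  shows "poisson_bracket (\<lambda>a b. \<pi> a b + wedge \<phi> \<psi> a b)"
  unfolding poisson_bracket_def
proof (intro conjI allI)
  show "derivation (\<lambda>b. \<pi> a b + wedge \<phi> \<psi> a b)" for a
    unfolding wedge_def
    by (intro derivation_plus derivation_minus derivation_times poisson_derivation \<pi> \<phi> \<psi>)
  show "\<pi> a b + wedge \<phi> \<psi> a b = - (\<pi> b a + wedge \<phi> \<psi> b a)" for a b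
    using poisson_skew[OF \<pi>, of a b] by (simp add: wedge_def algebra_simps)
next
  fix a b c
  note D = poisson_derivation[OF \<pi>]
  note rules = derivation_add[OF \<phi>(1)] derivation_add[OF \<psi>(1)] derivation_add[OF D]
    derivation_diff[OF \<phi>(1)] derivation_diff[OF \<psi>(1)] derivation_diff[OF D]
    derivation_mult[OF \<phi>(1)] derivation_mult[OF \<psi>(1)] derivation_mult[OF D]
    \<phi>(2) \<psi>(2) comm
  \<comment> \<open>These instances are oriented to give every bracket a normal form:
    \<open>a\<close>, \<open>b\<close>, \<open>c\<close> in alphabetical order, and images under
    \<open>\<phi>\<close> or \<open>\<psi>\<close> in the second argument. Unrestricted
    skew-symmetry would not orient the terms.\<close>
  have skew: "\<pi> b a = - \<pi> a b" "\<pi> c a = - \<pi> a c" "\<pi> c b = - \<pi> b c"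
    "\<pi> (\<phi> x) a = - \<pi> a (\<phi> x)" "\<pi> (\<phi> x) b = - \<pi> b (\<phi> x)" "\<pi> (\<phi> x) c = - \<pi> c (\<phi> x)"
    "\<pi> (\<psi> x) a = - \<pi> a (\<psi> x)" "\<pi> (\<psi> x) b = - \<pi> b (\<psi> x)" "\<pi> (\<psi> x) c = - \<pi> c (\<psi> x)" for x
    by (rule poisson_skew[OF \<pi>])+
  have jac: "\<pi> a (\<pi> b c) = \<pi> b (\<pi> a c) - \<pi> c (\<pi> a b)"
    using poisson_jacobi[OF \<pi>, of a b c]
    by (simp add: skew derivation_uminus[OF D] algebra_simps eq_neg_iff_add_eq_0)
  show "(\<pi> a (\<pi> b c + wedge \<phi> \<psi> b c) + wedge \<phi> \<psi> a (\<pi> b c + wedge \<phi> \<psi> b c)) +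
      (\<pi> b (\<pi> c a + wedge \<phi> \<psi> c a) + wedge \<phi> \<psi> b (\<pi> c a + wedge \<phi> \<psi> c a)) +
      (\<pi> c (\<pi> a b + wedge \<phi> \<psi> a b) + wedge \<phi> \<psi> c (\<pi> a b + wedge \<phi> \<psi> a b)) = 0"
    unfolding wedge_def
    by (simp add: rules skew jac derivation_uminus[OF D] algebra_simps)
qed

text \<open>\<open>poisson_bracket_wedge\<close> applies to the Euler derivation and
  \<open>\<delta>\<close>: the former is a Poisson derivation as \<open>\<pi>\<close> has degree 0,
  and they commute as \<open>\<delta>\<close> has degree 0.\<close>

lemma graded_poisson_bracket_twist:
  fixes \<pi> :: "('v::finite, 'k::field_char_0) mpol \<Rightarrow> ('v, 'k) mpol \<Rightarrow> ('v, 'k) mpol"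
  assumes \<pi>: "graded_poisson_bracket w \<pi>" and \<delta>: "graded_poisson_derivation w \<pi> \<delta>"
  shows "graded_poisson_bracket w (graded_twist w \<pi> \<delta>)"
  unfolding graded_poisson_bracket_def
proof (intro conjI allI impI)
  have "poisson_bracket (\<lambda>a b. \<pi> a b + wedge (euler w) \<delta> a b)"
    using assms
    by (intro poisson_bracket_wedge derivation_euler euler_poisson euler_commute)
      (auto simp: graded_poisson_bracket_def graded_poisson_derivation_def)
  then show "poisson_bracket (graded_twist w \<pi> \<delta>)"
    by (simp add: graded_twist_def[abs_def])
next
  fix d e and a b :: "('v, 'k) mpol"
  assume "homogeneous w d a" "homogeneous w e b"
  with assms show "homogeneous w (d + e) (graded_twist w \<pi> \<delta> a b)"
    unfolding graded_twist_def wedge_def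
    by (intro homogeneous_add homogeneous_diff homogeneous_mult homogeneous_euler)
      (auto simp: graded_poisson_bracket_def graded_poisson_derivation_def)
qed

lemma modular_graded_twist:
  assumes \<delta>: "graded_poisson_derivation w \<pi> \<delta>"
  shows "modular (graded_twist w \<pi> \<delta>) a =
    modular \<pi> a + const (of_int (\<Sum>i\<in>UNIV. w i)) * \<delta> a - euler w a * divergence \<delta>"
proof -
  have D: "derivation \<delta>" using \<delta> by (simp add: graded_poisson_derivation_def)
  \<comment> \<open>These are the two extra terms that \<open>divergence_times\<close> produces
    below. They enter with opposite signs and cancel.\<close>
  have "euler w (\<delta> a) = \<delta> (euler w a)"
    using \<delta> by (intro euler_commute) (auto simp: graded_poisson_derivation_def)
  moreover have "modular (graded_twist w \<pi> \<delta>) a =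
      - (divergence (\<pi> a) + (euler w a * divergence \<delta> + \<delta> (euler w a) -
        (\<delta> a * const (of_int (\<Sum>i\<in>UNIV. w i)) + euler w (\<delta> a))))"
    by (simp only: modular_def hamiltonian_def graded_twist_def wedge_def divergence_plus
        divergence_minus divergence_times[OF D] divergence_times[OF derivation_euler]
        divergence_euler)
  ultimately show ?thesis
    by (simp add: modular_def hamiltonian_def algebra_simps)
qed

theorem corollary0p3:
  fixes w :: "'v::finite \<Rightarrow> int"
    and \<pi> :: "('v, 'k::field_char_0) mpol \<Rightarrow> ('v, 'k) mpol \<Rightarrow> ('v, 'k) mpol"
  assumes "\<And>i. w i > 0"
    and "graded_poisson_bracket w \<pi>"
  shows "let l = (\<Sum>i\<in>UNIV. w i);
             \<delta> = (\<lambda>a. const (- (1 / of_int l)) * modular \<pi> a);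
             \<pi>_unim = graded_twist w \<pi> \<delta>
         in graded_poisson_derivation w \<pi> \<delta> \<and>
            graded_poisson_bracket w \<pi>_unim \<and>
            unimodular \<pi>_unim \<and>
            (\<forall>a b. \<pi> a b =
              \<pi>_unim a b + const (1 / of_int l) * wedge (euler w) (modular \<pi>) a b)"
proof -
  define l where "l = (\<Sum>i\<in>UNIV. w i)"
  define \<delta> where "\<delta> = (\<lambda>a. const (- (1 / of_int l)) * modular \<pi> a)"
  have \<pi>: "poisson_bracket \<pi>" using assms(2) by (simp add: graded_poisson_bracket_def)
  \<comment> \<open>Positive degrees make \<open>l\<close> nonzero, and characteristic zero makes it
    invertible in the field.\<close>
  have "l > 0" unfolding l_def using assms(1) by (intro sum_pos) auto
  then have inv: "const (of_int l) * const (- (1 / of_int l)) = (- 1 :: ('v, 'k) mpol)"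
    by (simp flip: const_mult add: const_uminus)
  have "graded_poisson_derivation w \<pi> (modular \<pi>)"
    using derivation_modular[OF \<pi>] modular_poisson[OF \<pi>] homogeneous_modular[OF assms(2)]
    by (auto simp: graded_poisson_derivation_def)
  then have \<delta>: "graded_poisson_derivation w \<pi> \<delta>"
    unfolding \<delta>_def by (rule graded_poisson_derivation_scale[OF \<pi>])
  have "divergence \<delta> = 0"
    unfolding \<delta>_def
    by (simp add: divergence_times[OF derivation_modular[OF \<pi>]] divergence_modular[OF \<pi>]
        derivation_const[OF derivation_modular[OF \<pi>]])
  \<comment> \<open>The factor in \<open>\<delta>\<close> is chosen for this: in
    \<open>modular_graded_twist\<close> the middle term now cancels \<open>modular \<pi> a\<close>,
    and the last one is 0.\<close>
  moreover have "const (of_int l) * \<delta> a = - modular \<pi> a" for a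
    unfolding \<delta>_def mult.assoc[symmetric] inv by simp
  ultimately have "unimodular (graded_twist w \<pi> \<delta>)"
    by (simp add: unimodular_def modular_graded_twist[OF \<delta>] flip: l_def)
  \<comment> \<open>The wedge is linear in its second factor, so the added term undoes the
    twist.\<close>
  moreover have "\<pi> a b =
      graded_twist w \<pi> \<delta> a b + const (1 / of_int l) * wedge (euler w) (modular \<pi>) a b" for a b
    by (simp add: graded_twist_def wedge_def \<delta>_def const_uminus algebra_simps)
  ultimately show ?thesis
    using \<delta> graded_poisson_bracket_twist[OF assms(2) \<delta>]
    unfolding Let_def \<delta>_def l_def by blast
qed

end
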